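(* Let $d>1$ be an integer, $\mathbb{O}_d=(\mathbb{R}_+)^d$, $F,G:\mathbb{O}_d\times\mathbb{R}^d\to\mathbb{R}^d$, $r>0$, $\lambda>0$ and $T\in\mathcal{L}(\mathbb{R}^d)$. Assume: (i) for every $x\in\mathbb{O}_d$, $p\in\mathbb{R}^d$ and $i\in\{1,\dots,d\}$, $x^i=0$ implies $F^i(x,p)\le 0$; moreover $T(\mathbb{O}_d)\subset\mathbb{O}_d$; (ii) there exists $R_*>0$ such that $\sum_{i=1}^d F^i(x,p)\ge 0$ for all $x\in\mathbb{O}_d$ with $|x|_1\ge R_*$ and all $p\in\mathbb{R}^d$; moreover $T(B^1_{R_*})\subset B^1_{R_*}$; (iii) $(G,F)$ is monotone, i.e. $\langle G(x,p)-G(y,q),x-y\rangle+\langle F(x,p)-F(y,q),p-q\rangle\ge 0$ for all $x,y\in\mathbb{O}_d$, $p,q\in\mathbb{R}^d$. Then there exists at most one continuous monotone solution $U:\mathbb{O}_d\to\mathbb{R}^d$ of the stationary master equation $$rU+(F(x,U)\cdot\nabla_x)U+\lambda\,(U-T^*U(Tx))=G(x,U)\quad\text{in }\mathbb{O}_d .$$ If it exists, it is a monotone map, i.e. $\langle U(x)-U(y),x-y\rangle\ge 0$ for all $x,y\in\mathbb{O}_d$.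
   Context: Notation: $|x|_1=x_1+\dots+x_d$ for $x\in\mathbb{O}_d$; $B^1_R=\{x\in\mathbb{O}_d:\ x_1+\dots+x_d\le R\}$; $T^*$ is the adjoint of $T$; $\langle\cdot,\cdot\rangle$ is the Euclidean scalar product. Definition (monotone solution). A function $U\in\mathcal{C}(\mathbb{O}_d,\mathbb{R}^d)$ is a monotone solution of the stationary master equation if for any $V\in\mathbb{R}^d$, $y\in\mathbb{O}_d$, any sufficiently large $R>0$ (i.e. any $R\ge R_0$ for some $R_0>0$ independent of $V$ and $y$), and any point $x_0\in B^1_R$ of strict minimum on $B^1_R$ of $x\mapsto\langle U(x)-V,x-y\rangle$ (the minimum over $B^1_R$ is attained at $x_0$ and only there), one has $$r\langle U(x_0),x_0-y\rangle+\lambda\langle U(x_0)-T^*U(Tx_0),x_0-y\rangle\ \ge\ \langle G(x_0,U(x_0)),x_0-y\rangle+\langle F(x_0,U(x_0)),U(x_0)-V\rangle .$$ *)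

theory Defs
  imports "HOL-Analysis.Analysis"
begin

definition orthant :: "(real ^ 'n) set" where
  "orthant = {x. \<forall>i. 0 \<le> x $ i}"

text \<open>On the orthant this is the 1-norm, so no absolute values are taken.\<close>

definition mass :: "real ^ 'n \<Rightarrow> real" where
  "mass x = (\<Sum>i\<in>UNIV. x $ i)"

definition mass_ball :: "real \<Rightarrow> (real ^ 'n) set" where
  "mass_ball R = {x \<in> orthant. mass x \<le> R}"

definition strict_min_on :: "('a \<Rightarrow> real) \<Rightarrow> 'a set \<Rightarrow> 'a \<Rightarrow> bool" where
  "strict_min_on f S x0 \<longleftrightarrow> x0 \<in> S \<and> (\<forall>x\<in>S. x \<noteq> x0 \<longrightarrow> f x0 < f x)"

text \<open>
  Monotone solutions of the stationary master equation
  \<open>r U + (F(x,U) \<cdot> \<nabla>) U + \<lambda> (U - T\<^sup>* U(T x)) = G(x,U)\<close> in the orthant.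
  The functions \<open>F\<close>, \<open>G\<close>, \<open>U\<close> are total in HOL, but only their values for
  \<open>x\<close> in the orthant matter (provided \<open>T\<close> maps the orthant into itself).
\<close>

definition monotone_solution ::
  "real \<Rightarrow> real \<Rightarrow> (real ^ 'n \<Rightarrow> real ^ 'n)
   \<Rightarrow> (real ^ 'n \<Rightarrow> real ^ 'n \<Rightarrow> real ^ 'n)
   \<Rightarrow> (real ^ 'n \<Rightarrow> real ^ 'n \<Rightarrow> real ^ 'n)
   \<Rightarrow> (real ^ 'n \<Rightarrow> real ^ 'n) \<Rightarrow> bool" where
  "monotone_solution r lam T F G U \<longleftrightarrow>
     continuous_on orthant U \<and>
     (\<exists>R0>0. \<forall>V. \<forall>y\<in>orthant. \<forall>R\<ge>R0. \<forall>x0\<in>mass_ball R.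
        strict_min_on (\<lambda>x. (U x - V) \<bullet> (x - y)) (mass_ball R) x0 \<longrightarrow>
          r * (U x0 \<bullet> (x0 - y)) + lam * ((U x0 - adjoint T (U (T x0))) \<bullet> (x0 - y))
            \<ge> G x0 (U x0) \<bullet> (x0 - y) + F x0 (U x0) \<bullet> (U x0 - V))"

end

theory Submission
  imports Defs
begin

text \<open>
  For two monotone solutions \<open>U\<close>, \<open>V\<close> put \<open>W(x,y) = \<langle>U(x) - V(y), x - y\<rangle>\<close>. On a simplex
  \<open>B\<^sub>R\<close>, which \<open>T\<close> preserves, take a minimum \<open>(x\<^sub>0,y\<^sub>0)\<close> of \<open>W(x,y) - \<delta>(|x|\<^sup>2 + |y|\<^sup>2)\<close>.
  Completing the square shows that \<open>x\<^sub>0\<close> is then a strict minimum of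
  \<open>x \<mapsto> \<langle>U(x) - V(y\<^sub>0) - 2\<delta>x\<^sub>0, x - y\<^sub>0\<rangle>\<close>, and symmetrically for \<open>y\<^sub>0\<close>. Adding the two
  inequalities of the definition, the monotonicity of \<open>(G,F)\<close> and the minimality of
  \<open>(x\<^sub>0,y\<^sub>0)\<close> against \<open>(Tx\<^sub>0,Ty\<^sub>0)\<close> give \<open>W \<ge> -C\<delta>\<close> on \<open>B\<^sub>R\<close>, provided that \<open>F\<close> is bounded
  on bounded sets. This boundedness is a consequence of monotonicity: some vertex \<open>v\<close> of
  \<open>B\<^sub>R\<close> satisfies \<open>\<langle>G(x,p), x - v\<rangle> \<le> 0\<close>, and comparing \<open>(x,p)\<close> with finitely many \<open>(v,q)\<close>
  bounds \<open>F(x,p)\<close>. Hence \<open>W \<ge> 0\<close>; for \<open>U = V\<close> this is the monotonicity of \<open>U\<close>, and in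
  general it forces \<open>U = V\<close> at interior points, by letting \<open>y \<rightarrow> x\<close> along rays.
\<close>

section \<open>The simplices \<open>mass_ball R\<close>: compactness and invariance under
  \<open>T\<close>\<close>

lemma norm_le_mass:
  fixes x :: "real ^ 'n"
  assumes "x \<in> orthant"
  shows "norm x \<le> mass x"
proof -
  have "norm x \<le> (\<Sum>i\<in>UNIV. \<bar>x $ i\<bar>)"
    by (rule norm_le_l1_cart)
  also have "\<dots> = mass x"
    using assms by (simp add: orthant_def mass_def)
  finally show ?thesis .
qed

lemma norm_le_mass_ball: "x \<in> mass_ball R \<Longrightarrow> norm x \<le> R"
  using norm_le_mass[of x] by (auto simp: mass_ball_def)

lemma closed_orthant: "closed (orthant :: (real ^ 'n) set)"
  unfolding orthant_def by (intro closed_Collect_all closed_Collect_le continuous_intros)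

lemma compact_mass_ball: "compact (mass_ball R :: (real ^ 'n) set)"
proof -
  have "closed {x :: real ^ 'n. mass x \<le> R}"
    unfolding mass_def by (intro closed_Collect_le continuous_intros)
  then have "closed (orthant \<inter> {x :: real ^ 'n. mass x \<le> R})"
    using closed_orthant by (rule closed_Int[rotated])
  moreover have "mass_ball R = orthant \<inter> {x :: real ^ 'n. mass x \<le> R}"
    by (auto simp: mass_ball_def)
  moreover have "bounded (mass_ball R :: (real ^ 'n) set)"
    using norm_le_mass_ball by (auto simp: bounded_iff)
  ultimately show ?thesis
    by (simp add: compact_eq_bounded_closed)
qed

lemma mass_scaleR: "mass (c *\<^sub>R x) = c * mass x"
  by (simp add: mass_def sum_distrib_left)

lemma orthant_scaleR: "0 \<le> c \<Longrightarrow> x \<in> orthant \<Longrightarrow> c *\<^sub>R x \<in> orthant"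
  by (simp add: orthant_def)

text \<open>Simplices of positive size are dilates of each other, so homogeneity of \<open>T\<close>
  carries invariance from one to all. This leaves \<open>R\<close> free to be as large as
  needed.\<close>

lemma linear_mass_ball_invariant:
  assumes lin: "linear T" and S: "0 < S" "T ` mass_ball S \<subseteq> mass_ball S"
    and R: "0 < R" and x: "x \<in> mass_ball R"
  shows "T x \<in> mass_ball R"
proof -
  have "(S / R) *\<^sub>R x \<in> mass_ball S"
    using x S R by (auto simp: mass_ball_def mass_scaleR orthant_scaleR field_simps)
  then have "(S / R) *\<^sub>R T x \<in> mass_ball S"
    using S(2) linear_scale[OF lin, of "S / R" x] by (metis image_subset_iff)
  then have *: "(S / R) *\<^sub>R T x \<in> orthant" "(S / R) * mass (T x) \<le> S"
    by (auto simp: mass_ball_def mass_scaleR)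
  have "(R / S) *\<^sub>R (S / R) *\<^sub>R T x \<in> orthant"
    using S R by (intro orthant_scaleR[OF _ *(1)]) auto
  moreover have "(R / S) *\<^sub>R (S / R) *\<^sub>R T x = T x"
    using S R by simp
  ultimately have "T x \<in> orthant"
    by (simp only:)
  then show ?thesis
    using * S R by (simp add: mass_ball_def field_simps)
qed

section \<open>Bounds on \<open>F\<close> from monotonicity\<close>

definition simplex_vertices :: "real \<Rightarrow> (real ^ 'n) set" where
  "simplex_vertices R = insert 0 (range (\<lambda>i. axis i R))"

lemma finite_simplex_vertices: "finite (simplex_vertices R)"
  by (simp add: simplex_vertices_def)

lemma simplex_vertices_subset:
  assumes "0 \<le> R"
  shows "simplex_vertices R \<subseteq> mass_ball R"
  using assms
  by (auto simp: simplex_vertices_def mass_ball_def orthant_def mass_def axis_def)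

text \<open>With \<open>i\<close> a largest coordinate of \<open>g\<close>, the vertex is
  \<open>axis i R\<close> if \<open>g $ i\<close> is positive and 0 otherwise. It serves to discard
  the uncontrolled term \<open>G x p\<close> from the monotonicity inequality.\<close>

lemma linear_functional_le_at_vertex:
  fixes g x :: "real ^ 'n"
  assumes x: "x \<in> mass_ball R"
  obtains v where "v \<in> simplex_vertices R" "g \<bullet> x \<le> g \<bullet> v"
proof -
  obtain i where i: "\<And>j. g $ j \<le> g $ i"
    using Max_in[of "range (($) g)"] Max_ge[of "range (($) g)"] by fastforce
  have nonneg: "0 \<le> x $ j" for j
    using x by (auto simp: mass_ball_def orthant_def)
  have le: "g \<bullet> x \<le> g $ i * mass x"
    using i nonneg by (auto simp: inner_vec_def mass_def sum_distrib_left intro!: sum_mono mult_right_mono)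
  have mass: "0 \<le> mass x" "mass x \<le> R"
    using x nonneg by (auto simp: mass_ball_def mass_def intro: sum_nonneg)
  show ?thesis
  proof (cases "g $ i \<le> 0")
    case True
    then have "g \<bullet> x \<le> g \<bullet> 0"
      using le mass mult_nonpos_nonneg[of "g $ i" "mass x"] by simp
    then show ?thesis
      by (rule that[rotated]) (simp add: simplex_vertices_def)
  next
    case False
    then have "g \<bullet> x \<le> g $ i * R"
      using le mass mult_left_mono[of "mass x" R "g $ i"] by linarith
    then have "g \<bullet> x \<le> g \<bullet> axis i R"
      by (simp add: inner_axis)
    then show ?thesis
      by (rule that[rotated]) (simp add: simplex_vertices_def)
  qed
qed

text \<open>Continuity of \<open>F\<close> is not assumed, so monotonicity has to supply the bound,
  in the way that monotone operators are locally bounded.\<close>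

lemma monotone_pair_bounded:
  fixes F G :: "real ^ 'n \<Rightarrow> real ^ 'n \<Rightarrow> real ^ 'n"
  assumes monotone_GF: "\<And>x y p q. x \<in> orthant \<Longrightarrow> y \<in> orthant \<Longrightarrow>
          (G x p - G y q) \<bullet> (x - y) + (F x p - F y q) \<bullet> (p - q) \<ge> 0"
    and R: "0 \<le> R" and P: "0 \<le> P"
  obtains C where "0 \<le> C" "\<And>x p. x \<in> mass_ball R \<Longrightarrow> norm p \<le> P \<Longrightarrow> norm (F x p) \<le> C"
proof -
  define n where "n = real CARD('n)"
  \<comment> \<open>Summing over the \<open>n\<close> coordinates will give
    \<open>M * norm (F x p) \<le> n * (B + norm (F x p) * P)\<close>; the surplus 1 over
    \<open>n * P\<close> lets the right-hand norm be absorbed.\<close>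
  define M where "M = n * P + 1"
  define Q where "Q = range (\<lambda>i :: 'n. axis i M) \<union> range (\<lambda>i :: 'n. axis i (- M))"
  \<comment> \<open>The vertex \<open>v\<close> will depend on \<open>x\<close> and
    \<open>p\<close>, so \<open>B\<close> covers all pairs at once; \<open>2 * R\<close> bounds
    \<open>norm (x - v)\<close> and \<open>P + M\<close> bounds \<open>norm (p - q)\<close>.\<close>
  define B where
    "B = (\<Sum>(v, q)\<in>simplex_vertices R \<times> Q. norm (G v q) * (2 * R) + norm (F v q) * (P + M))"
  have M: "0 < M"
    using P by (simp add: M_def n_def add_nonneg_pos)
  have summand_le: "norm (G v q) * (2 * R) + norm (F v q) * (P + M) \<le> B"
    if "v \<in> simplex_vertices R" "q \<in> Q" for v q
  proof -
    have "(case (v, q) of (v, q) \<Rightarrow> norm (G v q) * (2 * R) + norm (F v q) * (P + M)) \<le> B"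
      unfolding B_def
      by (rule member_le_sum) (use that R P M in \<open>auto simp: Q_def finite_simplex_vertices\<close>)
    then show ?thesis by simp
  qed
  have B: "0 \<le> B"
    unfolding B_def using R P M by (intro sum_nonneg) auto
  have "norm (F x p) \<le> n * B" if x: "x \<in> mass_ball R" and p: "norm p \<le> P" for x p
  proof -
    have Fq: "- B \<le> F x p \<bullet> (p - q)" if q: "q \<in> Q" for q
    proof -
      obtain v where v: "v \<in> simplex_vertices R" "G x p \<bullet> x \<le> G x p \<bullet> v"
        using linear_functional_le_at_vertex[OF x] .
      have v_ball: "v \<in> mass_ball R"
        using v(1) simplex_vertices_subset[OF R] by auto
      have "(G x p - G v q) \<bullet> (x - v) + (F x p - F v q) \<bullet> (p - q) \<ge> 0"
        using x v_ball by (intro monotone_GF) (auto simp: mass_ball_def)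
      then have "F x p \<bullet> (p - q) \<ge> G v q \<bullet> (x - v) + F v q \<bullet> (p - q)"
        using v(2) by (simp add: inner_diff_left inner_diff_right)
      moreover have "\<bar>G v q \<bullet> (x - v)\<bar> \<le> norm (G v q) * (2 * R)"
      proof -
        have "norm (x - v) \<le> 2 * R"
          using norm_triangle_ineq4[of x v] norm_le_mass_ball[OF x] norm_le_mass_ball[OF v_ball]
          by linarith
        then show ?thesis
          by (meson Cauchy_Schwarz_ineq2 mult_left_mono norm_ge_zero order_trans)
      qed
      moreover have "\<bar>F v q \<bullet> (p - q)\<bar> \<le> norm (F v q) * (P + M)"
      proof -
        have "norm q = M"
          using q M by (auto simp: Q_def norm_eq_sqrt_inner inner_axis_axis)
        then have "norm (p - q) \<le> P + M"
          using norm_triangle_ineq4[of p q] p by linarith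
        then show ?thesis
          by (meson Cauchy_Schwarz_ineq2 mult_left_mono norm_ge_zero order_trans)
      qed
      ultimately show ?thesis
        using summand_le[OF v(1) q] by linarith
    qed
    \<comment> \<open>The two signs in \<open>Q\<close> control the coordinate from both
      sides.\<close>
    have coord: "M * \<bar>F x p $ i\<bar> \<le> B + F x p \<bullet> p" for i
    proof -
      have "- B \<le> F x p \<bullet> (p - axis i M)" "- B \<le> F x p \<bullet> (p - axis i (- M))"
        by (rule Fq; simp add: Q_def)+
      then show ?thesis
        by (auto simp: inner_diff_right inner_axis abs_if algebra_simps)
    qed
    have Fp: "F x p \<bullet> p \<le> norm (F x p) * P"
      using norm_cauchy_schwarz[of "F x p" p] mult_left_mono[OF p norm_ge_zero[of "F x p"]]
      by linarith
    have "M * norm (F x p) \<le> M * (\<Sum>i\<in>UNIV. \<bar>F x p $ i\<bar>)"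
      using M norm_le_l1_cart[of "F x p"] by (intro mult_left_mono) auto
    also have "\<dots> \<le> (\<Sum>i\<in>(UNIV :: 'n set). B + norm (F x p) * P)"
      unfolding sum_distrib_left using coord Fp by (intro sum_mono) (smt (verit))
    also have "\<dots> = n * (B + norm (F x p) * P)"
      by (simp add: n_def)
    finally show ?thesis
      by (simp add: M_def algebra_simps)
  qed
  moreover have "0 \<le> n * B"
    using B by (simp add: n_def)
  ultimately show ?thesis
    using that by blast
qed

section \<open>Comparison of two solutions by doubling of variables\<close>

lemma monotone_solutions_cross_monotone:
  fixes F G :: "real ^ 'n \<Rightarrow> real ^ 'n \<Rightarrow> real ^ 'n"
  assumes r: "r > 0" and lam: "lam > 0"
    and T_linear: "linear T"
    and T_ball: "0 < S" "T ` mass_ball S \<subseteq> mass_ball S"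
    and monotone_GF: "\<And>x y p q. x \<in> orthant \<Longrightarrow> y \<in> orthant \<Longrightarrow>
          (G x p - G y q) \<bullet> (x - y) + (F x p - F y q) \<bullet> (p - q) \<ge> 0"
    and U: "monotone_solution r lam T F G U"
    and V: "monotone_solution r lam T F G V"
    and x: "x \<in> orthant" and y: "y \<in> orthant"
  shows "0 \<le> (U x - V y) \<bullet> (x - y)"
proof -
  obtain RU where RU: "continuous_on orthant U" "0 < RU"
    "\<And>Z y R x0. y \<in> orthant \<Longrightarrow> RU \<le> R \<Longrightarrow> x0 \<in> mass_ball R \<Longrightarrow>
        strict_min_on (\<lambda>x. (U x - Z) \<bullet> (x - y)) (mass_ball R) x0 \<Longrightarrow>
          r * (U x0 \<bullet> (x0 - y)) + lam * ((U x0 - adjoint T (U (T x0))) \<bullet> (x0 - y))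
            \<ge> G x0 (U x0) \<bullet> (x0 - y) + F x0 (U x0) \<bullet> (U x0 - Z)"
    using U unfolding monotone_solution_def by blast
  obtain RV where RV: "continuous_on orthant V" "0 < RV"
    "\<And>Z y R x0. y \<in> orthant \<Longrightarrow> RV \<le> R \<Longrightarrow> x0 \<in> mass_ball R \<Longrightarrow>
        strict_min_on (\<lambda>x. (V x - Z) \<bullet> (x - y)) (mass_ball R) x0 \<Longrightarrow>
          r * (V x0 \<bullet> (x0 - y)) + lam * ((V x0 - adjoint T (V (T x0))) \<bullet> (x0 - y))
            \<ge> G x0 (V x0) \<bullet> (x0 - y) + F x0 (V x0) \<bullet> (V x0 - Z)"
    using V unfolding monotone_solution_def by blast
  \<comment> \<open>Large enough for the definition to apply to both solutions and for the simplex
    to contain both given points.\<close>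
  define R where "R = max (max RU RV) (max (mass x) (mass y))"
  have R: "0 < R" "RU \<le> R" "RV \<le> R"
    using RU(2) by (auto simp: R_def)
  define K :: "(real ^ 'n) set" where "K = mass_ball R"
  have K_orthant: "z \<in> orthant" if "z \<in> K" for z
    using that by (simp add: K_def mass_ball_def)
  have xy: "x \<in> K" "y \<in> K"
    using x y by (auto simp: K_def mass_ball_def R_def)
  have TK: "T z \<in> K" if "z \<in> K" for z
    using linear_mass_ball_invariant[OF T_linear T_ball R(1)] that by (simp add: K_def)
  have K_norm: "norm z \<le> R" if "z \<in> K" for z
    using that norm_le_mass_ball by (auto simp: K_def)
  have compK: "compact K"
    by (simp add: K_def compact_mass_ball)
  have cU: "continuous_on K U" and cV: "continuous_on K V"
    using RU(1) RV(1) K_orthant by (auto intro: continuous_on_subset)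
  have "bounded (U ` K)" "bounded (V ` K)"
    using compK cU cV by (auto intro: compact_imp_bounded compact_continuous_image)
  then have "bounded (U ` K \<union> V ` K)"
    by simp
  then obtain P where P: "0 < P" "\<And>z. z \<in> K \<Longrightarrow> norm (U z) \<le> P" "\<And>z. z \<in> K \<Longrightarrow> norm (V z) \<le> P"
    unfolding bounded_pos by blast
  have "0 \<le> R" "0 \<le> P"
    using R(1) P(1) by auto
  with monotone_GF obtain C
    where C: "0 \<le> C" "\<And>x p. x \<in> K \<Longrightarrow> norm p \<le> P \<Longrightarrow> norm (F x p) \<le> C"
    unfolding K_def by (rule monotone_pair_bounded) blast+
  define W where "W x y = (U x - V y) \<bullet> (x - y)" for x y
  have W_lower: "0 \<le> r * (W x y + \<delta> * (2 * R\<^sup>2)) + lam * (\<delta> * (2 * R\<^sup>2)) + 4 * \<delta> * (C * R)"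
    if \<delta>: "0 < \<delta>" for \<delta>
  proof -
    \<comment> \<open>The squares are subtracted so that at a minimum \<open>W\<close> lies above a
      strictly convex paraboloid touching it there, which makes the minimum strict after a linear
      correction.\<close>
    define \<phi> where "\<phi> z = W (fst z) (snd z) - \<delta> * ((norm (fst z))\<^sup>2 + (norm (snd z))\<^sup>2)"
      for z :: "(real ^ 'n) \<times> (real ^ 'n)"
    have cont: "continuous_on (K \<times> K) \<phi>"
      unfolding \<phi>_def W_def
      by (intro continuous_intros continuous_on_compose2[OF cU] continuous_on_compose2[OF cV]) auto
    have "compact (K \<times> K)" "K \<times> K \<noteq> {}"
      using compK xy by (auto intro: compact_Times)
    from continuous_attains_inf[OF this cont] obtain x0 y0
      where x0: "x0 \<in> K" and y0: "y0 \<in> K"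
        and \<phi>_min: "\<And>a b. a \<in> K \<Longrightarrow> b \<in> K \<Longrightarrow> \<phi> (x0, y0) \<le> \<phi> (a, b)"
      by auto
    have W_min: "W x0 y0 \<le> W a b + \<delta> * ((norm x0)\<^sup>2 + (norm y0)\<^sup>2) - \<delta> * ((norm a)\<^sup>2 + (norm b)\<^sup>2)"
      if "a \<in> K" "b \<in> K" for a b
      using \<phi>_min[OF that] by (simp add: \<phi>_def)
    have square_pos: "0 < \<delta> * (norm (a - b))\<^sup>2" if "a \<noteq> b" for a b :: "real ^ 'n"
      using that \<delta> by simp
    \<comment> \<open>The difference of the squared norms of \<open>a\<close> and \<open>x0\<close>
      is \<open>2 * (x0 \<bullet> (a - x0))\<close> plus the square of \<open>norm (a - x0)\<close>:
      the linear part goes into the shift, the square gives strictness.\<close>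
    have "strict_min_on (\<lambda>x. (U x - (V y0 + (2 * \<delta>) *\<^sub>R x0)) \<bullet> (x - y0)) (mass_ball R) x0"
      unfolding strict_min_on_def K_def[symmetric]
    proof (intro conjI ballI impI x0)
      fix a assume a: "a \<in> K" "a \<noteq> x0"
      show "(U x0 - (V y0 + (2 * \<delta>) *\<^sub>R x0)) \<bullet> (x0 - y0) < (U a - (V y0 + (2 * \<delta>) *\<^sub>R x0)) \<bullet> (a - y0)"
        using W_min[OF a(1) y0] square_pos[OF a(2)]
        unfolding W_def power2_norm_eq_inner
        by (simp add: inner_diff_left inner_diff_right inner_add_left inner_commute algebra_simps)
    qed
    from RU(3)[OF K_orthant[OF y0] R(2) x0[unfolded K_def] this]
    have eqU: "r * (U x0 \<bullet> (x0 - y0)) + lam * ((U x0 - adjoint T (U (T x0))) \<bullet> (x0 - y0))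
        \<ge> G x0 (U x0) \<bullet> (x0 - y0) + F x0 (U x0) \<bullet> (U x0 - (V y0 + (2 * \<delta>) *\<^sub>R x0))" .
    have "strict_min_on (\<lambda>y. (V y - (U x0 + (2 * \<delta>) *\<^sub>R y0)) \<bullet> (y - x0)) (mass_ball R) y0"
      unfolding strict_min_on_def K_def[symmetric]
    proof (intro conjI ballI impI y0)
      fix b assume b: "b \<in> K" "b \<noteq> y0"
      show "(V y0 - (U x0 + (2 * \<delta>) *\<^sub>R y0)) \<bullet> (y0 - x0) < (V b - (U x0 + (2 * \<delta>) *\<^sub>R y0)) \<bullet> (b - x0)"
        using W_min[OF x0 b(1)] square_pos[OF b(2)]
        unfolding W_def power2_norm_eq_inner
        by (simp add: inner_diff_left inner_diff_right inner_add_left inner_commute algebra_simps)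
    qed
    from RV(3)[OF K_orthant[OF x0] R(3) y0[unfolded K_def] this]
    have eqV: "r * (V y0 \<bullet> (y0 - x0)) + lam * ((V y0 - adjoint T (V (T y0))) \<bullet> (y0 - x0))
        \<ge> G y0 (V y0) \<bullet> (y0 - x0) + F y0 (V y0) \<bullet> (V y0 - (U x0 + (2 * \<delta>) *\<^sub>R y0))" .
    have adj: "adjoint T p \<bullet> z = p \<bullet> T z" for p z
      using adjoint_works[OF T_linear, of z p] by (simp add: inner_commute)
    have "r * (U x0 \<bullet> (x0 - y0)) + r * (V y0 \<bullet> (y0 - x0)) = r * W x0 y0"
      unfolding W_def by (simp add: inner_diff_left inner_diff_right algebra_simps)
    \<comment> \<open>Moving the adjoints across turns the nonlocal terms into
      \<open>W (T x0) (T y0)\<close>, which near-minimality of \<open>W x0 y0\<close> controls since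
      \<open>T\<close> preserves \<open>K\<close>.\<close>
    moreover have "lam * ((U x0 - adjoint T (U (T x0))) \<bullet> (x0 - y0))
        + lam * ((V y0 - adjoint T (V (T y0))) \<bullet> (y0 - x0)) = lam * (W x0 y0 - W (T x0) (T y0))"
      unfolding W_def
      by (simp add: adj linear_diff[OF T_linear] inner_diff_left inner_diff_right algebra_simps)
    moreover have "(G x0 (U x0) - G y0 (V y0)) \<bullet> (x0 - y0) + (F x0 (U x0) - F y0 (V y0)) \<bullet> (U x0 - V y0) \<ge> 0"
      by (intro monotone_GF K_orthant x0 y0)
    \<comment> \<open>The shifts leave only an error with factor \<open>\<delta>\<close>, which the
      bound \<open>C\<close> on \<open>F\<close> makes vanish in the limit.\<close>
    moreover have "G x0 (U x0) \<bullet> (x0 - y0) + F x0 (U x0) \<bullet> (U x0 - (V y0 + (2 * \<delta>) *\<^sub>R x0))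
        + (G y0 (V y0) \<bullet> (y0 - x0) + F y0 (V y0) \<bullet> (V y0 - (U x0 + (2 * \<delta>) *\<^sub>R y0)))
      = (G x0 (U x0) - G y0 (V y0)) \<bullet> (x0 - y0) + (F x0 (U x0) - F y0 (V y0)) \<bullet> (U x0 - V y0)
        - 2 * \<delta> * (F x0 (U x0) \<bullet> x0 + F y0 (V y0) \<bullet> y0)"
      by (simp add: inner_diff_left inner_diff_right inner_add_right algebra_simps)
    ultimately have key: "0 \<le> r * W x0 y0 + lam * (W x0 y0 - W (T x0) (T y0))
        + 2 * \<delta> * (F x0 (U x0) \<bullet> x0 + F y0 (V y0) \<bullet> y0)"
      using eqU eqV by linarith
    have inner_le: "f \<bullet> z \<le> C * R" if "norm f \<le> C" "z \<in> K" for f z :: "real ^ 'n"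
      using norm_cauchy_schwarz[of f z] mult_mono[OF that(1) K_norm[OF that(2)] C(1)] by simp
    have "F x0 (U x0) \<bullet> x0 + F y0 (V y0) \<bullet> y0 \<le> 2 * (C * R)"
      using inner_le[OF C(2)[OF x0 P(2)[OF x0]] x0] inner_le[OF C(2)[OF y0 P(3)[OF y0]] y0] by simp
    then have F_le: "2 * \<delta> * (F x0 (U x0) \<bullet> x0 + F y0 (V y0) \<bullet> y0) \<le> 2 * \<delta> * (2 * (C * R))"
      using \<delta> by (intro mult_left_mono) auto
    have W_le: "W x0 y0 \<le> W a b + \<delta> * (2 * R\<^sup>2)" if "a \<in> K" "b \<in> K" for a b
    proof -
      have "(norm x0)\<^sup>2 + (norm y0)\<^sup>2 \<le> 2 * R\<^sup>2"
        using power_mono[OF K_norm[OF x0], of 2] power_mono[OF K_norm[OF y0], of 2] by simp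
      then have "\<delta> * ((norm x0)\<^sup>2 + (norm y0)\<^sup>2) \<le> \<delta> * (2 * R\<^sup>2)"
        using \<delta> by (intro mult_left_mono) auto
      moreover have "0 \<le> \<delta> * ((norm a)\<^sup>2 + (norm b)\<^sup>2)"
        using \<delta> by simp
      ultimately show ?thesis
        using W_min[OF that] by linarith
    qed
    have "r * W x0 y0 \<le> r * (W x y + \<delta> * (2 * R\<^sup>2))"
      using W_le[OF xy] r by (intro mult_left_mono) auto
    moreover have "lam * (W x0 y0 - W (T x0) (T y0)) \<le> lam * (\<delta> * (2 * R\<^sup>2))"
      using W_le[OF TK[OF x0] TK[OF y0]] lam by (intro mult_left_mono) auto
    ultimately show ?thesis
      using key F_le by linarith
  qed
  have "((\<lambda>\<delta>. r * (W x y + \<delta> * (2 * R\<^sup>2)) + lam * (\<delta> * (2 * R\<^sup>2)) + 4 * \<delta> * (C * R))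
      \<longlongrightarrow> r * (W x y + 0 * (2 * R\<^sup>2)) + lam * (0 * (2 * R\<^sup>2)) + 4 * 0 * (C * R)) (at_right 0)"
    by (intro tendsto_intros)
  moreover have "eventually (\<lambda>\<delta>. 0 \<le> r * (W x y + \<delta> * (2 * R\<^sup>2)) + lam * (\<delta> * (2 * R\<^sup>2)) + 4 * \<delta> * (C * R))
      (at_right 0)"
    using W_lower by (auto intro: eventually_mono[OF eventually_at_right_less])
  ultimately have "0 \<le> r * (W x y + 0 * (2 * R\<^sup>2)) + lam * (0 * (2 * R\<^sup>2)) + 4 * 0 * (C * R)"
    by (rule tendsto_lowerbound) simp
  then show ?thesis
    using r by (simp add: W_def zero_le_mult_iff)
qed

section \<open>Uniqueness from cross-monotonicity\<close>

text \<open>Minty's argument gives equality at interior points, where every direction is admissible;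
  continuity extends it to the boundary.\<close>

lemma cross_monotone_imp_eq:
  fixes U V :: "real ^ 'n \<Rightarrow> real ^ 'n"
  assumes cU: "continuous_on orthant U" and cV: "continuous_on orthant V"
    and cross: "\<And>x y. x \<in> orthant \<Longrightarrow> y \<in> orthant \<Longrightarrow> 0 \<le> (U x - V y) \<bullet> (x - y)"
    and x: "x \<in> orthant"
  shows "U x = V x"
proof -
  have interior: "U w = V w" if w: "\<And>i. 0 < w $ i" for w
  proof -
    \<comment> \<open>Along this ray, dividing the cross inequality by \<open>- t\<close> and
      letting \<open>t\<close> tend to 0 gives \<open>z \<bullet> z \<le> 0\<close>.\<close>
    define z where "z = U w - V w"
    define \<gamma> where "\<gamma> t = w + t *\<^sub>R z" for t
    have w_orthant: "w \<in> orthant"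
      using w by (auto simp: orthant_def intro: less_imp_le)
    have \<gamma>_lim: "(\<gamma> \<longlongrightarrow> w) (at_right 0)"
      unfolding \<gamma>_def by (auto intro!: tendsto_eq_intros)
    have "eventually (\<lambda>t. 0 < \<gamma> t $ i) (at_right 0)" for i
      by (rule order_tendstoD(1)[OF tendsto_vec_nth[OF \<gamma>_lim] w])
    then have ev: "eventually (\<lambda>t. \<gamma> t \<in> orthant) (at_right 0)"
      unfolding orthant_def mem_Collect_eq
      by (intro eventually_all_finite) (blast intro: eventually_mono less_imp_le)
    have "((\<lambda>t. V (\<gamma> t)) \<longlongrightarrow> V w) (at_right 0)"
      by (rule continuous_on_tendsto_compose[OF cV \<gamma>_lim w_orthant ev])
    then have lim: "((\<lambda>t. (U w - V (\<gamma> t)) \<bullet> z) \<longlongrightarrow> (U w - V w) \<bullet> z) (at_right 0)"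
      by (intro tendsto_intros)
    have "eventually (\<lambda>t. (U w - V (\<gamma> t)) \<bullet> z \<le> 0) (at_right 0)"
      using ev eventually_at_right_less[of "0 :: real"]
    proof eventually_elim
      case (elim t)
      then show ?case
        using cross[OF w_orthant, of "\<gamma> t"] by (simp add: \<gamma>_def mult_le_0_iff)
    qed
    then have "(U w - V w) \<bullet> z \<le> 0"
      by (rule tendsto_upperbound[OF lim]) simp
    then show ?thesis
      using inner_gt_zero_iff[of z] by (simp add: z_def not_less[symmetric])
  qed
  \<comment> \<open>The all-ones direction leads from any point of the orthant into the
    interior.\<close>
  define \<eta> where "\<eta> t = x + t *\<^sub>R (1 :: real ^ 'n)" for t
  have \<eta>_lim: "(\<eta> \<longlongrightarrow> x) (at_right 0)"
    unfolding \<eta>_def by (auto intro!: tendsto_eq_intros)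
  have pos: "0 < \<eta> t $ i" if "0 < t" for t i
    using x that by (auto simp: \<eta>_def orthant_def add_nonneg_pos)
  have ev: "eventually (\<lambda>t. \<eta> t \<in> orthant) (at_right 0)"
    using eventually_at_right_less[of "0 :: real"]
    by eventually_elim (use pos in \<open>auto simp: orthant_def intro: less_imp_le\<close>)
  have limU: "((\<lambda>t. U (\<eta> t)) \<longlongrightarrow> U x) (at_right 0)"
    by (rule continuous_on_tendsto_compose[OF cU \<eta>_lim x ev])
  have limV: "((\<lambda>t. V (\<eta> t)) \<longlongrightarrow> V x) (at_right 0)"
    by (rule continuous_on_tendsto_compose[OF cV \<eta>_lim x ev])
  have "eventually (\<lambda>t. U (\<eta> t) = V (\<eta> t)) (at_right 0)"
    using eventually_at_right_less[of "0 :: real"]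
    by eventually_elim (use interior pos in auto)
  then have "((\<lambda>t. V (\<eta> t)) \<longlongrightarrow> U x) (at_right 0)"
    using limU by (rule Lim_transform_eventually[rotated])
  with limV show ?thesis
    using tendsto_unique[of "at_right (0 :: real)"] by auto
qed

theorem theorem2p1:
  fixes F G :: "real ^ 'n \<Rightarrow> real ^ 'n \<Rightarrow> real ^ 'n"
    and T :: "real ^ 'n \<Rightarrow> real ^ 'n"
    and r lam :: real
  assumes dim: "CARD('n) > 1"
    and r: "r > 0" and lam: "lam > 0"
    and T_linear: "linear T"
    and F_boundary: "\<And>x p i. x \<in> orthant \<Longrightarrow> x $ i = 0 \<Longrightarrow> F x p $ i \<le> 0"
    and T_orthant: "T ` orthant \<subseteq> orthant"
    and growth: "\<exists>Rs>0. (\<forall>x\<in>orthant. \<forall>p. mass x \<ge> Rs \<longrightarrow> (\<Sum>i\<in>UNIV. F x p $ i) \<ge> 0)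
                        \<and> T ` mass_ball Rs \<subseteq> mass_ball Rs"
    and monotone_GF: "\<And>x y p q. x \<in> orthant \<Longrightarrow> y \<in> orthant \<Longrightarrow>
          (G x p - G y q) \<bullet> (x - y) + (F x p - F y q) \<bullet> (p - q) \<ge> 0"
  shows "(\<forall>U1 U2. monotone_solution r lam T F G U1 \<longrightarrow> monotone_solution r lam T F G U2 \<longrightarrow>
            (\<forall>x\<in>orthant. U1 x = U2 x))
       \<and> (\<forall>U. monotone_solution r lam T F G U \<longrightarrow>
            (\<forall>x\<in>orthant. \<forall>y\<in>orthant. (U x - U y) \<bullet> (x - y) \<ge> 0))"
proof -
  obtain S where S: "0 < S" "T ` mass_ball S \<subseteq> mass_ball S"
    using growth by blast
  have cross: "0 \<le> (U x - V y) \<bullet> (x - y)"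
    if "monotone_solution r lam T F G U" "monotone_solution r lam T F G V" "x \<in> orthant" "y \<in> orthant"
    for U V x y
    by (rule monotone_solutions_cross_monotone[OF r lam T_linear S _ that]) (rule monotone_GF)
  have "U1 x = U2 x"
    if "monotone_solution r lam T F G U1" "monotone_solution r lam T F G U2" "x \<in> orthant" for U1 U2 x
    using that cross[OF that(1,2)]
    by (intro cross_monotone_imp_eq) (auto simp: monotone_solution_def)
  then show ?thesis
    using cross by blast
qed

end
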